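(* Let $k\ge 1$ be a fixed integer and let $G_{\le k}(z)$ be the generating function (by size) of closed lambda-terms in which all bindings have unary length at most $k$. Then $$[z^n]G_{\le k}(z)\sim \sqrt{\frac{2k+\sqrt{k}}{4\pi\prod_{j=2}^{k+1}c_j}}\; n^{-3/2}\,(1+2\sqrt{k})^n,\qquad n\to\infty,$$ where $c_1=1$ and $c_j=4j-5+2\sqrt{c_{j-1}}$ for $2\le j\le k+1$.
   Context: A Motzkin tree is a finite plane rooted tree in which every node has 0, 1 or 2 children (leaf, unary node, binary node). A closed lambda-term (up to $\alpha$-equivalence) is a Motzkin tree together with a map assigning to every leaf $e$ one unary node $v$ on the path from the root to $e$ (the abstraction binding $e$). The size of a term is its total number of nodes. The unary length of the binding of $e$ by $v$ is the number of unary nodes on the path from $v$ to $e$ in the Motzkin tree, with $v$ itself counted. $G_{\le k}(z)=\sum_n g_n z^n$, where $g_n$ is the number of closed lambda-terms of size $n$ in which all bindings have unary length at most $k$. Equivalently, $G_{\le k}=\hat P^{(0,k)}$, where $\hat P^{(k,k)}(z)=\frac{1-z-\sqrt{(1-z)^2-4kz^2}}{2z}$ and $\hat P^{(i,k)}(z)=\frac{1-\sqrt{1-4iz^2-4z^2\hat P^{(i+1,k)}(z)}}{2z}$ for $0\le i<k$. The notation $a_n\sim b_n$ means $a_n/b_n\to1$. *)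

theory Defs
  imports
    Complex_Main
    "HOL-Library.FuncSet"
    "HOL-Library.Sublist"
    "HOL-Library.Landau_Symbols"
    "HOL-Computational_Algebra.Formal_Power_Series"
begin

datatype motzkin = Leaf | Unary motzkin | Binary motzkin motzkin

primrec num_nodes :: "motzkin \<Rightarrow> nat" where
  "num_nodes Leaf = 1"
| "num_nodes (Unary t) = 1 + num_nodes t"
| "num_nodes (Binary l r) = 1 + num_nodes l + num_nodes r"

text \<open>
  A node is identified with its position, the list of steps leading to it from the root.
  Hence \<open>u\<close> lies on the path from the root to \<open>e\<close> iff \<open>u\<close> is a prefix of \<open>e\<close>.
\<close>

datatype dir = Down | Lft | Rgt

type_synonym pos = "dir list"

primrec leaves :: "motzkin \<Rightarrow> pos set" where
  "leaves Leaf = {[]}"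
| "leaves (Unary t) = (#) Down ` leaves t"
| "leaves (Binary l r) = (#) Lft ` leaves l \<union> (#) Rgt ` leaves r"

primrec unary_nodes :: "motzkin \<Rightarrow> pos set" where
  "unary_nodes Leaf = {}"
| "unary_nodes (Unary t) = insert [] ((#) Down ` unary_nodes t)"
| "unary_nodes (Binary l r) = (#) Lft ` unary_nodes l \<union> (#) Rgt ` unary_nodes r"

definition possible_binders :: "motzkin \<Rightarrow> pos \<Rightarrow> pos set" where
  "possible_binders t e = {v \<in> unary_nodes t. prefix v e}"

text \<open>
  Closed lambda-terms up to alpha-equivalence. The extensional function space makes the
  binding map irrelevant outside the leaves, so that each term is counted once.
\<close>

definition closed_terms :: "(motzkin \<times> (pos \<Rightarrow> pos)) set" where
  "closed_terms = (SIGMA t:UNIV. (\<Pi>\<^sub>E e\<in>leaves t. possible_binders t e))"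

definition unary_length :: "motzkin \<Rightarrow> pos \<Rightarrow> pos \<Rightarrow> nat" where
  "unary_length t v e = card {u \<in> unary_nodes t. prefix v u \<and> prefix u e}"

definition bounded_terms :: "nat \<Rightarrow> (motzkin \<times> (pos \<Rightarrow> pos)) set" where
  "bounded_terms k = {(t, b) \<in> closed_terms. \<forall>e\<in>leaves t. unary_length t (b e) e \<le> k}"

definition bounded_terms_of_size :: "nat \<Rightarrow> nat \<Rightarrow> (motzkin \<times> (pos \<Rightarrow> pos)) set" where
  "bounded_terms_of_size k n = {(t, b) \<in> bounded_terms k. num_nodes t = n}"

definition G_le :: "nat \<Rightarrow> real fps" where
  "G_le k = Abs_fps (\<lambda>n. real (card (bounded_terms_of_size k n)))"

lemma finite_leaves [simp]: "finite (leaves t)"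
  by (induction t) auto

lemma finite_unary_nodes [simp]: "finite (unary_nodes t)"
  by (induction t) auto

lemma num_nodes_pos: "num_nodes t > 0"
  by (cases t) auto

lemma finite_motzkin_size_le: "finite {t. num_nodes t \<le> n}"
proof (induction n)
  case 0
  have "{t. num_nodes t \<le> 0} = {}"
    using num_nodes_pos by (metis (no_types, lifting) Collect_empty_eq leD)
  then show ?case by (simp only: finite.emptyI)
next
  case (Suc n)
  let ?A = "{t. num_nodes t \<le> n}"
  have "{t. num_nodes t \<le> Suc n} \<subseteq> {Leaf} \<union> Unary ` ?A \<union> (\<lambda>(l, r). Binary l r) ` (?A \<times> ?A)"
  proof
    fix t assume "t \<in> {t. num_nodes t \<le> Suc n}"
    then show "t \<in> {Leaf} \<union> Unary ` ?A \<union> (\<lambda>(l, r). Binary l r) ` (?A \<times> ?A)"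
      by (cases t) auto
  qed
  then show ?case by (rule finite_subset) (use Suc in auto)
qed

text \<open>Each size class is finite, so the cardinality in \<open>G_le\<close> is a genuine count.\<close>

lemma finite_bounded_terms_of_size: "finite (bounded_terms_of_size k n)"
proof (rule finite_subset)
  show "bounded_terms_of_size k n \<subseteq>
    (SIGMA t:{t. num_nodes t \<le> n}. (\<Pi>\<^sub>E e\<in>leaves t. possible_binders t e))"
    by (auto simp: bounded_terms_of_size_def bounded_terms_def closed_terms_def)
  show "finite (SIGMA t:{t. num_nodes t \<le> n}. (\<Pi>\<^sub>E e\<in>leaves t. possible_binders t e))"
    by (intro finite_SigmaI finite_motzkin_size_le finite_PiE)
       (auto simp: possible_binders_def)
qed

end

theory Submission
  imports
    Defs
    "HOL-Analysis.Gamma_Function"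
    "HOL-Analysis.Generalised_Binomial_Theorem"
    "HOL-Real_Asymp.Real_Asymp"
begin

text \<open>
  All radicands but the innermost one stay positive at \<open>\<rho> = 1 / (1 + 2 * sqrt k)\<close>, where the innermost
  one vanishes; after rescaling by \<open>\<rho>\<close> their values there are \<open>\<rho>\<^sup>2 * c\<^sub>j\<close>. The coefficients of the
  innermost square root are asymptotic to a constant times \<open>n powr (-3/2)\<close> by the generalised binomial
  series. Instead of singularity analysis, this asymptotics is carried outwards by an elementary
  argument: if \<open>U\<close> has nonnegative coefficients \<open>u\<^sub>n \<sim> C * n powr (-3/2)\<close> with sum less than \<open>1\<close>,
  then \<open>w = 1 - sqrt (1 - U)\<close> satisfies \<open>2 * w = U + w\<^sup>2\<close>. In the convolution \<open>w\<^sup>2\<close> one of the two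
  indices is always small, so that, by dominated convergence, the recursion for \<open>w\<^sub>n / n powr (-3/2)\<close>
  is asymptotically a contraction, which forces the limit \<open>C / (2 * sqrt (1 - U(1)))\<close>.
\<close>

section \<open>Counting the binding maps\<close>

text \<open>The number of admissible binding maps on \<open>t\<close> when \<open>i\<close> further
  unary nodes lie above its root: a leaf may choose among the \<open>k\<close> nearest unary nodes,
  or among all of them if there are fewer.\<close>

primrec weight :: "nat \<Rightarrow> nat \<Rightarrow> motzkin \<Rightarrow> nat" where
  "weight k i Leaf = min k i"
| "weight k i (Unary t) = weight k (Suc i) t"
| "weight k i (Binary l r) = weight k i l * weight k i r"

lemma possible_binders_simps [simp]:
  "possible_binders Leaf e = {}"
  "possible_binders (Unary t) (Down # e) = insert [] ((#) Down ` possible_binders t e)"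
  "possible_binders (Binary l r) (Lft # e) = (#) Lft ` possible_binders l e"
  "possible_binders (Binary l r) (Rgt # e) = (#) Rgt ` possible_binders r e"
  by (auto simp: possible_binders_def)

lemma finite_possible_binders [simp]: "finite (possible_binders t e)"
  by (simp add: possible_binders_def)

lemma unary_length_eq: "unary_length t v e = card {u \<in> possible_binders t e. prefix v u}"
  unfolding unary_length_def possible_binders_def by (rule arg_cong[of _ _ card]) auto

lemma unary_length_simps [simp]:
  "unary_length (Unary t) [] (Down # e) = Suc (card (possible_binders t e))"
  "unary_length (Unary t) (Down # v) (Down # e) = unary_length t v e"
  "unary_length (Binary l r) (Lft # v) (Lft # e) = unary_length l v e"
  "unary_length (Binary l r) (Rgt # v) (Rgt # e) = unary_length r v e"
proof -
  have *: "card {u \<in> (#) d ` A. prefix (d # v) u} = card {u \<in> A. prefix v u}" for d :: dir and A v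
  proof -
    have "{u \<in> (#) d ` A. prefix (d # v) u} = (#) d ` {u \<in> A. prefix v u}"
      by auto
    then show ?thesis
      by (simp add: card_image)
  qed
  have "[] \<notin> (#) Down ` possible_binders t e"
    by auto
  then have "card (possible_binders (Unary t) (Down # e)) = Suc (card (possible_binders t e))"
    by (simp add: card_image)
  then show "unary_length (Unary t) [] (Down # e) = Suc (card (possible_binders t e))"
    by (simp add: unary_length_eq del: possible_binders_simps)
  have "{u \<in> insert [] ((#) Down ` possible_binders t e). prefix (Down # v) u}
      = {u \<in> (#) Down ` possible_binders t e. prefix (Down # v) u}"
    by auto
  then show "unary_length (Unary t) (Down # v) (Down # e) = unary_length t v e"
    by (simp add: unary_length_eq *)
  show "unary_length (Binary l r) (Lft # v) (Lft # e) = unary_length l v e"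
    "unary_length (Binary l r) (Rgt # v) (Rgt # e) = unary_length r v e"
    by (simp_all add: unary_length_eq *)
qed

text \<open>The unary nodes above \<open>e\<close> form a chain, and seen from \<open>e\<close>
  their unary lengths are 1, 2, 3 and so on. The bound \<open>k\<close> therefore selects the
  nearest \<open>k\<close> of them.\<close>

lemma card_short_binders:
  assumes "e \<in> leaves t"
  shows "card {v \<in> possible_binders t e. unary_length t v e \<le> k} = min k (card (possible_binders t e))"
  using assms
proof (induction t arbitrary: e)
  case Leaf
  then show ?case by simp
next
  case (Unary t)
  then obtain e' where e: "e = Down # e'" "e' \<in> leaves t"
    by auto
  \<comment> \<open>The new root is the farthest candidate, with length one more than the number of
    the others; the lengths of the others are unchanged.\<close>
  have eq: "{v \<in> possible_binders (Unary t) e. unary_length (Unary t) v e \<le> k} =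
    (if Suc (card (possible_binders t e')) \<le> k then {[]} else {}) \<union>
    (#) Down ` {v \<in> possible_binders t e'. unary_length t v e' \<le> k}"
    by (auto simp: e)
  have "card {v \<in> possible_binders (Unary t) e. unary_length (Unary t) v e \<le> k} =
    (if Suc (card (possible_binders t e')) \<le> k then 1 else 0) + min k (card (possible_binders t e'))"
    unfolding eq Unary.IH[OF e(2), symmetric]
    by (subst card_Un_disjoint) (auto simp: card_image)
  moreover have "card (possible_binders (Unary t) e) = Suc (card (possible_binders t e'))"
    using e by (auto simp: card_image card_insert_if)
  ultimately show ?case
    by auto
next
  case (Binary l r)
  then consider e' where "e = Lft # e'" "e' \<in> leaves l" | e' where "e = Rgt # e'" "e' \<in> leaves r"
    by auto
  then show ?case
  proof cases
    case 1
    have "{v \<in> possible_binders (Binary l r) e. unary_length (Binary l r) v e \<le> k} =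
      (#) Lft ` {v \<in> possible_binders l e'. unary_length l v e' \<le> k}"
      by (auto simp: 1)
    then show ?thesis
      using Binary.IH(1)[OF 1(2)] by (simp add: 1 card_image)
  next
    case 2
    have "{v \<in> possible_binders (Binary l r) e. unary_length (Binary l r) v e \<le> k} =
      (#) Rgt ` {v \<in> possible_binders r e'. unary_length r v e' \<le> k}"
      by (auto simp: 2)
    then show ?thesis
      using Binary.IH(2)[OF 2(2)] by (simp add: 2 card_image)
  qed
qed

text \<open>The offset \<open>i\<close> makes the induction go through: below a unary root every
  leaf sees one more candidate, which is the passage from \<open>i\<close> to
  \<open>Suc i\<close>.\<close>

lemma prod_min_card_binders:
  "(\<Prod>e\<in>leaves t. min k (i + card (possible_binders t e))) = weight k i t"
proof (induction t arbitrary: i)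
  case Leaf
  then show ?case by simp
next
  case (Unary t)
  have "[] \<notin> (#) Down ` possible_binders t e" for e
    by auto
  then have "card (possible_binders (Unary t) (Down # e)) = Suc (card (possible_binders t e))" for e
    by (simp add: card_image)
  then show ?case
    using Unary.IH[of "Suc i"] by (simp add: prod.reindex del: possible_binders_simps)
next
  case (Binary l r)
  show ?case
    using Binary.IH
    by (subst leaves.simps, subst prod.union_disjoint) (auto simp: prod.reindex card_image)
qed

text \<open>On a fixed tree the length bound constrains each leaf separately, so the binding maps
  form an extensional product whose cardinality is a product over the leaves.\<close>

lemma card_bounded_terms_of_size:
  "card (bounded_terms_of_size k n) = (\<Sum>t | num_nodes t = n. weight k 0 t)"
proof -
  have fin: "finite {t. num_nodes t = n}"
    by (rule finite_subset[OF _ finite_motzkin_size_le[of n]]) auto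
  have "bounded_terms_of_size k n = (SIGMA t:{t. num_nodes t = n}.
      \<Pi>\<^sub>E e\<in>leaves t. {v \<in> possible_binders t e. unary_length t v e \<le> k})"
    by (auto simp: bounded_terms_of_size_def bounded_terms_def closed_terms_def PiE_iff extensional_def)
  also have "card \<dots> = (\<Sum>t | num_nodes t = n.
      card (\<Pi>\<^sub>E e\<in>leaves t. {v \<in> possible_binders t e. unary_length t v e \<le> k}))"
    using fin by (intro card_SigmaI) (auto intro!: finite_PiE)
  also have "\<dots> = (\<Sum>t | num_nodes t = n. weight k 0 t)"
    by (intro sum.cong refl)
      (simp add: card_PiE card_short_binders flip: prod_min_card_binders)
  finally show ?thesis .
qed

section \<open>Generating functions of the weighted trees\<close>

text \<open>
  The series \<open>P\<^sup>(\<^sup>i\<^sup>,\<^sup>k\<^sup>)\<close> of the paper with the variable rescaled by \<open>r\<close>.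
\<close>

definition tree_fps :: "nat \<Rightarrow> real \<Rightarrow> nat \<Rightarrow> real fps" where
  "tree_fps k r i = Abs_fps (\<lambda>n. r ^ n * real (\<Sum>t | num_nodes t = n. weight k i t))"

lemma tree_fps_nth: "fps_nth (tree_fps k r i) n = r ^ n * real (\<Sum>t | num_nodes t = n. weight k i t)"
  by (simp add: tree_fps_def)

lemma fps_nth_G_le: "r ^ n * fps_nth (G_le k) n = fps_nth (tree_fps k r 0) n"
  by (simp add: tree_fps_nth G_le_def card_bounded_terms_of_size)

text \<open>With at least \<open>k\<close> unary nodes above the root every leaf has exactly
  \<open>k\<close> choices. The levels from \<open>k\<close> on thus coincide, which closes the
  system of recursions.\<close>

lemma weight_cong:
  assumes "k \<le> i" "k \<le> j"
  shows "weight k i t = weight k j t"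
  using assms
proof (induction t arbitrary: i j)
  case (Unary t)
  have "weight k (Suc i) t = weight k (Suc j) t"
    using Unary.prems by (intro Unary.IH) auto
  then show ?case by simp
next
  case (Binary l r)
  then show ?case by (metis weight.simps(3))
qed auto

lemma tree_fps_cong: "k \<le> i \<Longrightarrow> k \<le> j \<Longrightarrow> tree_fps k r i = tree_fps k r j"
  by (simp add: tree_fps_def weight_cong[of k i j])

text \<open>Decomposition at the root: a leaf, a unary node whose subtree is one level deeper, or a
  binary node with both subtrees on the same level. The outer factor accounts for the root
  itself.\<close>

lemma tree_fps_eq:
  "tree_fps k r i = fps_const r * fps_X *
    (fps_const (real (min k i)) + tree_fps k r (Suc i) + tree_fps k r i * tree_fps k r i)"
proof (rule fps_ext)
  fix n
  let ?T = "\<lambda>n. {t. num_nodes t = n}"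
  let ?S = "\<lambda>i n. real (\<Sum>t\<in>?T n. weight k i t)"
  have fin: "finite (?T n)" for n
    by (rule finite_subset[OF _ finite_motzkin_size_le[of n]]) auto
  show "fps_nth (tree_fps k r i) n = fps_nth (fps_const r * fps_X *
    (fps_const (real (min k i)) + tree_fps k r (Suc i) + tree_fps k r i * tree_fps k r i)) n"
  proof (cases n)
    case 0
    have T0: "?T 0 = {}"
      using num_nodes_pos by force
    then show ?thesis
      using 0 by (simp only: tree_fps_nth mult.assoc fps_mult_left_const_nth fps_X_mult_nth T0) simp
  next
    case (Suc m)
    \<comment> \<open>A tree of size \<open>Suc m\<close> has \<open>m\<close> nodes besides its
      root, so the leaf occurs only for \<open>m = 0\<close>.\<close>
    let ?L = "if m = 0 then {Leaf} else {}"
    let ?U = "Unary ` ?T m"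
    let ?B = "(\<lambda>(l, r). Binary l r) ` (\<Union>j\<in>{..m}. ?T j \<times> ?T (m - j))"
    have T: "?T (Suc m) = ?L \<union> (?U \<union> ?B)"
    proof (intro equalityI subsetI)
      fix t assume "t \<in> ?T (Suc m)"
      then show "t \<in> ?L \<union> (?U \<union> ?B)"
        by (cases t) (auto simp: image_iff)
    qed (auto split: if_splits)
    have finB: "finite (\<Union>j\<in>{..m}. ?T j \<times> ?T (m - j))"
      using fin by auto
    have inj: "inj_on Unary A" "inj_on (\<lambda>(l, r). Binary l r) C" for A C
      by (auto simp: inj_on_def)
    have B: "(\<Sum>t\<in>?B. weight k i t) = (\<Sum>j\<le>m. (\<Sum>t\<in>?T j. weight k i t) * (\<Sum>t\<in>?T (m - j). weight k i t))"
    proof -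
      have "(\<Sum>t\<in>?B. weight k i t)
          = (\<Sum>(l, r)\<in>(\<Union>j\<in>{..m}. ?T j \<times> ?T (m - j)). weight k i l * weight k i r)"
        by (subst sum.reindex[OF inj(2)]) (auto intro!: sum.cong)
      also have "\<dots> = (\<Sum>j\<le>m. \<Sum>(l, r)\<in>?T j \<times> ?T (m - j). weight k i l * weight k i r)"
        using fin by (intro sum.UNION_disjoint) auto
      finally show ?thesis
        by (simp add: sum_product sum.cartesian_product)
    qed
    have "(\<Sum>t\<in>?T (Suc m). weight k i t) =
      (\<Sum>t\<in>?L. weight k i t) + ((\<Sum>t\<in>?U. weight k i t) + (\<Sum>t\<in>?B. weight k i t))"
      unfolding T using fin finB
      by (subst sum.union_disjoint, auto, subst sum.union_disjoint, auto)
    also have "\<dots> = (if m = 0 then min k i else 0) + ((\<Sum>t\<in>?T m. weight k (Suc i) t)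
        + (\<Sum>j\<le>m. (\<Sum>t\<in>?T j. weight k i t) * (\<Sum>t\<in>?T (m - j). weight k i t)))"
      unfolding B by (subst sum.reindex[OF inj(1)]) auto
    finally have S: "?S i (Suc m) = (if m = 0 then real (min k i) else 0) + (?S (Suc i) m
        + (\<Sum>j\<le>m. ?S i j * ?S i (m - j)))"
      by (simp only: of_nat_add of_nat_sum of_nat_mult if_distrib[of real] of_nat_0)
    \<comment> \<open>Rescaling is compatible with products because the exponents in a convolution
      add up to \<open>m\<close>.\<close>
    have "fps_nth (tree_fps k r i * tree_fps k r i) m = r ^ m * (\<Sum>j\<le>m. ?S i j * ?S i (m - j))"
      unfolding fps_mult_nth sum_distrib_left tree_fps_nth atLeast0AtMost
    proof (intro sum.cong refl)
      fix j assume "j \<in> {..m}"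
      then have "r ^ m = r ^ j * r ^ (m - j)"
        by (simp flip: power_add)
      then show "r ^ j * ?S i j * (r ^ (m - j) * ?S i (m - j)) = r ^ m * (?S i j * ?S i (m - j))"
        by (simp only: mult_ac)
    qed
    then have "fps_nth (fps_const r * fps_X *
      (fps_const (real (min k i)) + tree_fps k r (Suc i) + tree_fps k r i * tree_fps k r i)) n
      = r * ((if m = 0 then real (min k i) else 0) + r ^ m * ?S (Suc i) m + r ^ m * (\<Sum>j\<le>m. ?S i j * ?S i (m - j)))"
      by (simp only: Suc mult.assoc fps_mult_left_const_nth fps_X_mult_nth fps_add_nth fps_nth_fps_const
          tree_fps_nth) simp
    also have "\<dots> = r ^ n * ?S i n"
      unfolding S Suc by (simp add: algebra_simps)
    finally show ?thesis
      by (simp only: tree_fps_nth)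
  qed
qed

section \<open>Convolutions of sequences of order $n^{-3/2}$\<close>

text \<open>The shift by 1 keeps the value positive at \<open>n = 0\<close>, where
  \<open>0 powr (-3/2)\<close> would be 0, so quotients by \<open>decay\<close> give bounds valid
  for all \<open>n\<close>.\<close>

definition decay :: "nat \<Rightarrow> real" where
  "decay n = (real n + 1) powr (-3/2)"

lemma decay_pos [simp]: "decay n > 0"
  by (simp add: decay_def)

lemma decay_nonneg [simp]: "decay n \<ge> 0"
  by (simp add: decay_def)

lemma decay_nonzero [simp]: "decay n \<noteq> 0"
  using decay_pos[of n] by linarith

lemma summable_decay: "summable decay"
proof -
  have "summable (\<lambda>n. real n powr (-3/2))"
    by (subst summable_real_powr_iff) auto
  then have "summable (\<lambda>n. real (Suc n) powr (-3/2))"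
    by (subst summable_Suc_iff)
  then show ?thesis
    by (simp add: decay_def [abs_def] add.commute)
qed

text \<open>Since \<open>n - j + 1 >= (n + 1) / 2\<close>, replacing the large index of a half
  convolution by \<open>n\<close> costs only a constant factor. This supplies the dominating series
  below.\<close>

lemma decay_half_le:
  assumes "2 * j \<le> n"
  shows "decay (n - j) \<le> 2 powr (3/2) * decay n"
proof -
  have "(real (n - j) + 1) powr (-3/2) \<le> ((real n + 1) / 2) powr (-3/2)"
    using assms by (intro powr_mono2') (auto simp: of_nat_diff)
  also have "\<dots> = 2 powr (3/2) * (real n + 1) powr (-3/2)"
    by (simp add: powr_divide powr_minus field_simps)
  finally show ?thesis
    by (simp add: decay_def)
qed

lemma decay_shift: "(\<lambda>n. decay (n - j) / decay n) \<longlonglongrightarrow> 1"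
proof -
  have "(\<lambda>n. ((real n - real j + 1) / (real n + 1)) powr (-3/2)) \<longlonglongrightarrow> 1 powr (-3/2)"
    by (intro tendsto_powr tendsto_const) (real_asymp, simp)
  moreover have "\<forall>\<^sub>F n in sequentially.
      ((real n - real j + 1) / (real n + 1)) powr (-3/2) = decay (n - j) / decay n"
    using eventually_ge_at_top[of j]
    by eventually_elim (simp add: decay_def of_nat_diff powr_divide)
  ultimately show ?thesis
    by (simp add: filterlim_cong[OF refl refl])
qed

lemma tendsto_decay_shift:
  assumes "(\<lambda>n. y n / decay n) \<longlonglongrightarrow> D"
  shows "(\<lambda>n. y (n - j) / decay n) \<longlonglongrightarrow> D"
proof -
  have "(\<lambda>n. (y (n - j) / decay (n - j)) * (decay (n - j) / decay n)) \<longlonglongrightarrow> D * 1"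
    using assms filterlim_minus_const_nat_at_top[of j] decay_shift
    by (intro tendsto_mult filterlim_compose[OF assms])
  then show ?thesis
    by (simp add: mult.assoc)
qed

lemma bounded_of_tendsto_decay:
  assumes "(\<lambda>n. y n / decay n) \<longlonglongrightarrow> D"
  obtains K where "K > 0" "\<And>n. \<bar>y n\<bar> \<le> K * decay n"
proof -
  obtain K where K: "K > 0" "\<And>n. norm (y n / decay n) \<le> K"
    using convergentI[OF assms, THEN convergent_imp_Bseq] by (auto elim!: BseqE)
  have "\<bar>y n\<bar> \<le> K * decay n" for n
    using K(2)[of n] by (simp add: pos_divide_le_eq)
  then show thesis
    using K(1) that by blast
qed

lemma summable_of_tendsto_decay:
  assumes "(\<lambda>n. y n / decay n) \<longlonglongrightarrow> D"
  shows "summable (\<lambda>n. \<bar>y n\<bar>)"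
proof -
  obtain K where K: "\<And>n. \<bar>y n\<bar> \<le> K * decay n"
    using bounded_of_tendsto_decay[OF assms] by metis
  have "summable (\<lambda>n. K * decay n)"
    by (rule summable_mult[OF summable_decay])
  then show ?thesis
    by (rule summable_comparison_test'[where N = 0]) (simp add: K)
qed

text \<open>
  \<open>J n\<close> is \<open>{j. 2 * j \<le> n}\<close> or \<open>{j. 2 * j < n}\<close>: the two halves of a convolution differ in the
  treatment of the middle term.
\<close>

lemma half_convolution_tendsto:
  fixes x y :: "nat \<Rightarrow> real"
  assumes x: "summable (\<lambda>n. \<bar>x n\<bar>)"
    and y: "(\<lambda>n. y n / decay n) \<longlonglongrightarrow> D"
    and J: "\<And>n. J n \<subseteq> {j. 2 * j \<le> n}" "\<And>j. \<forall>\<^sub>F n in sequentially. j \<in> J n"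
  shows "(\<lambda>n. (\<Sum>j\<in>J n. x j * y (n - j)) / decay n) \<longlonglongrightarrow> (\<Sum>j. x j) * D"
proof -
  obtain K where K: "K > 0" "\<And>n. \<bar>y n\<bar> \<le> K * decay n"
    using bounded_of_tendsto_decay[OF y] by blast
  \<comment> \<open>Extension by zero outside \<open>J n\<close> turns the finite sums into series
    over all \<open>j\<close>, as Tannery's theorem requires; each fixed \<open>j\<close> eventually
    lies in \<open>J n\<close>.\<close>
  define f where "f j n = (if j \<in> J n then x j * (y (n - j) / decay n) else 0)" for j n
  \<comment> \<open>The bound \<open>K\<close> on \<open>y\<close> times the constant from
    \<open>decay_half_le\<close>.\<close>
  define C where "C = K * 2 powr (3/2)"
  have "((\<lambda>n. \<Sum>j. f j n) \<longlongrightarrow> (\<Sum>j. x j * D)) sequentially"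
  proof (rule conjunct2[OF conjunct2[OF tannerys_theorem[where M = "\<lambda>j. C * \<bar>x j\<bar>"]]])
    fix j
    have "(\<lambda>n. x j * (y (n - j) / decay n)) \<longlonglongrightarrow> x j * D"
      by (intro tendsto_mult tendsto_const tendsto_decay_shift y)
    moreover have "\<forall>\<^sub>F n in sequentially. x j * (y (n - j) / decay n) = f j n"
      using J(2)[of j] by eventually_elim (simp add: f_def)
    ultimately show "(f j \<longlongrightarrow> x j * D) sequentially"
      by (rule Lim_transform_eventually)
  next
    have "norm (f j n) \<le> C * \<bar>x j\<bar>" for j n
    proof (cases "j \<in> J n")
      case True
      have "\<bar>y (n - j)\<bar> \<le> K * decay (n - j)"
        by (rule K)
      also have "\<dots> \<le> K * (2 powr (3/2) * decay n)"
        using J(1)[of n] True K(1) by (intro mult_left_mono decay_half_le) auto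
      finally have "\<bar>y (n - j)\<bar> / decay n \<le> C"
        by (simp add: C_def field_simps)
      then have "\<bar>x j\<bar> * (\<bar>y (n - j)\<bar> / decay n) \<le> \<bar>x j\<bar> * C"
        by (intro mult_left_mono) auto
      then show ?thesis
        using True by (simp add: f_def abs_mult mult.commute)
    next
      case False
      then show ?thesis
        using K by (simp add: f_def C_def)
    qed
    then show "\<forall>\<^sub>F (j, n) in at_top \<times>\<^sub>F sequentially. norm (f j n) \<le> C * \<bar>x j\<bar>"
      by (simp add: case_prod_unfold)
    show "summable (\<lambda>j. C * \<bar>x j\<bar>)"
      by (rule summable_mult[OF x])
  qed auto
  moreover have "(\<Sum>j. f j n) = (\<Sum>j\<in>J n. x j * y (n - j)) / decay n" for n
  proof -
    have "finite (J n)"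
      by (rule finite_subset[of _ "{..n}"]) (use J(1)[of n] in force)+
    then have "(\<Sum>j. f j n) = (\<Sum>j\<in>J n. f j n)"
      by (intro suminf_finite) (auto simp: f_def)
    then show ?thesis
      by (simp add: f_def sum_divide_distrib)
  qed
  moreover have "(\<Sum>j. x j * D) = (\<Sum>j. x j) * D"
    by (rule suminf_mult2[symmetric, OF summable_rabs_cancel[OF x]])
  ultimately show ?thesis
    by simp
qed

lemma half_index_sets:
  "{j. 2 * j \<le> n} \<subseteq> {j. 2 * j \<le> (n::nat)}"
  "{j. 2 * j < n} \<subseteq> {j. 2 * j \<le> (n::nat)}"
  "\<forall>\<^sub>F n in sequentially. j \<in> {j. 2 * j \<le> (n::nat)}"
  "\<forall>\<^sub>F n in sequentially. j \<in> {j. 2 * j < (n::nat)}"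
proof -
  show "\<forall>\<^sub>F n in sequentially. j \<in> {j. 2 * j \<le> (n::nat)}"
    unfolding mem_Collect_eq by (rule eventually_ge_at_top)
  show "\<forall>\<^sub>F n in sequentially. j \<in> {j. 2 * j < (n::nat)}"
    unfolding mem_Collect_eq by (rule eventually_gt_at_top)
qed auto

text \<open>Reflecting \<open>j\<close> to \<open>n - j\<close> in the upper half makes the
  summation index small in both sums; the middle term is kept in the first one.\<close>

lemma convolution_split:
  fixes x y :: "nat \<Rightarrow> real"
  shows "(\<Sum>j\<le>n. x j * y (n - j)) =
    (\<Sum>j | 2 * j \<le> n. x j * y (n - j)) + (\<Sum>j | 2 * j < n. y j * x (n - j))"
proof -
  have fin: "finite {j. 2 * j \<le> n}" "finite {j. j \<le> n \<and> n < 2 * j}"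
    by (rule finite_subset[of _ "{..n}"]; auto)+
  have "{..n} = {j. 2 * j \<le> n} \<union> {j. j \<le> n \<and> n < 2 * j}"
    by auto
  then have "(\<Sum>j\<le>n. x j * y (n - j)) =
    (\<Sum>j | 2 * j \<le> n. x j * y (n - j)) + (\<Sum>j | j \<le> n \<and> n < 2 * j. x j * y (n - j))"
    using fin by (simp add: sum.union_disjoint[symmetric] disjoint_iff)
  also have "(\<Sum>j | j \<le> n \<and> n < 2 * j. x j * y (n - j)) = (\<Sum>j | 2 * j < n. y j * x (n - j))"
    by (rule sum.reindex_bij_witness[where i = "\<lambda>j. n - j" and j = "\<lambda>j. n - j"]) auto
  finally show ?thesis .
qed

text \<open>In each half the factor with the small index contributes its total sum and the other
  factor its limit.\<close>

lemma convolution_tendsto: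
  fixes x y :: "nat \<Rightarrow> real"
  assumes x: "(\<lambda>n. x n / decay n) \<longlonglongrightarrow> C" and y: "(\<lambda>n. y n / decay n) \<longlonglongrightarrow> D"
  shows "(\<lambda>n. (\<Sum>j\<le>n. x j * y (n - j)) / decay n) \<longlonglongrightarrow> (\<Sum>j. x j) * D + (\<Sum>j. y j) * C"
proof -
  show ?thesis
    unfolding convolution_split add_divide_distrib
    by (rule tendsto_add[OF
      half_convolution_tendsto[OF summable_of_tendsto_decay[OF x] y half_index_sets(1,3)]
      half_convolution_tendsto[OF summable_of_tendsto_decay[OF y] x half_index_sets(2,4)]])
qed

section \<open>Coefficients of a square root\<close>

text \<open>
  Below, \<open>w\<close> is the coefficient sequence of \<open>1 - sqrt (1 - U)\<close>, where \<open>u\<close> is that of \<open>U\<close>.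
\<close>

locale sqrt_recursion =
  fixes u w :: "nat \<Rightarrow> real"
  assumes u_nonneg: "\<And>n. u n \<ge> 0" and w_nonneg: "\<And>n. w n \<ge> 0" and w_0: "w 0 = 0"
    and rec: "\<And>n. 2 * w n = u n + (\<Sum>j\<le>n. w j * w (n - j))"
    and summable_u: "summable u" and suminf_u: "(\<Sum>n. u n) < 1"
begin

text \<open>The value of \<open>1 - sqrt (1 - U)\<close> at 1, that is, the smaller root of
  \<open>2 * x = U(1) + x^2\<close>.\<close>

definition w_total where "w_total = 1 - sqrt (1 - (\<Sum>n. u n))"

lemma w_total_bounds: "w_total \<ge> 0" "w_total < 1"
  using suminf_u suminf_nonneg[OF summable_u] u_nonneg by (simp_all add: w_total_def)

lemma w_total_eq: "2 * w_total = (\<Sum>n. u n) + w_total\<^sup>2"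
proof -
  have "(1 - w_total)\<^sup>2 = 1 - (\<Sum>n. u n)"
    using suminf_u by (simp add: w_total_def)
  then show ?thesis
    by (simp add: power2_eq_square algebra_simps)
qed

text \<open>Because \<open>w 0 = 0\<close>, the recursion bounds each partial sum by half of
  \<open>U(1)\<close> plus the square of the preceding partial sum, and \<open>w_total\<close> is a
  fixed point of this monotone map.\<close>

lemma partial_sum_le: "(\<Sum>n<N. w n) \<le> w_total"
proof (induction N)
  case (Suc N)
  have "(\<Sum>n<Suc N. \<Sum>j\<le>n. w j * w (n - j)) \<le> w_total\<^sup>2"
  proof -
    have "(\<Sum>n<Suc N. \<Sum>j\<le>n. w j * w (n - j)) = (\<Sum>(n, j)\<in>(SIGMA n:{..<Suc N}. {..n}). w j * w (n - j))"
      by (subst sum.Sigma) auto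
    also have "\<dots> = (\<Sum>(i, j) | i + j < Suc N. w i * w j)"
      by (rule sum.reindex_bij_witness[where j = "\<lambda>(n, j). (j, n - j)" and i = "\<lambda>(i, j). (i + j, i)"])
        auto
    \<comment> \<open>Once both indices are nonzero, \<open>i + j < Suc N\<close> forces each of
      them below \<open>N\<close>, so only the preceding partial sum occurs.\<close>
    also have "\<dots> = (\<Sum>(i, j)\<in>{(i, j). i + j < Suc N \<and> i \<noteq> 0 \<and> j \<noteq> 0}. w i * w j)"
    proof (rule sum.mono_neutral_right)
      show "finite {(i, j). i + j < Suc N}"
        by (rule finite_subset[of _ "{..N} \<times> {..N}"]) auto
    qed (auto intro!: gr0I simp: w_0)
    also have "\<dots> \<le> (\<Sum>(i, j)\<in>{..<N} \<times> {..<N}. w i * w j)"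
      by (rule sum_mono2) (auto simp: w_nonneg)
    also have "\<dots> = (\<Sum>n<N. w n)\<^sup>2"
      by (simp add: power2_eq_square sum_product sum.cartesian_product)
    also have "\<dots> \<le> w_total\<^sup>2"
      using Suc.IH by (intro power_mono sum_nonneg w_nonneg)
    finally show ?thesis .
  qed
  moreover have "(\<Sum>n<Suc N. u n) \<le> (\<Sum>n. u n)"
    by (intro sum_le_suminf summable_u) (auto simp: u_nonneg)
  moreover have "2 * (\<Sum>n<Suc N. w n) = (\<Sum>n<Suc N. u n) + (\<Sum>n<Suc N. \<Sum>j\<le>n. w j * w (n - j))"
    unfolding sum_distrib_left rec by (rule sum.distrib)
  ultimately show ?case
    using w_total_eq by linarith
qed (simp add: w_total_bounds)

lemma summable_w: "summable w"
  by (rule summableI_nonneg_bounded[OF w_nonneg partial_sum_le])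

text \<open>By the Cauchy product the sum solves the same quadratic equation as
  \<open>w_total\<close>. The other root \<open>2 - w_total\<close> exceeds 1 and is excluded by
  \<open>partial_sum_le\<close>.\<close>

lemma suminf_w: "(\<Sum>n. w n) = w_total"
proof -
  let ?W = "\<Sum>n. w n"
  have abs: "summable (\<lambda>n. norm (w n))"
    using summable_w by (simp add: w_nonneg)
  have "?W * ?W = (\<Sum>n. \<Sum>j\<le>n. w j * w (n - j))"
    using Cauchy_product[OF abs abs] by simp
  also have "\<dots> = (\<Sum>n. 2 * w n - u n)"
    by (simp add: rec)
  also have "\<dots> = 2 * ?W - (\<Sum>n. u n)"
    by (simp add: suminf_diff[symmetric] suminf_mult summable_w summable_u summable_mult)
  finally have "(1 - ?W)\<^sup>2 = (1 - w_total)\<^sup>2"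
    using w_total_eq by (simp add: power2_eq_square algebra_simps)
  moreover have "?W \<le> w_total"
    by (intro suminf_le_const summable_w partial_sum_le)
  ultimately show ?thesis
    using w_total_bounds by (simp add: power2_eq_iff)
qed

text \<open>This limit is the contraction factor: both halves of the convolution contribute it, and
  the 2 in the recursion averages them.\<close>

lemma half_sum_decay_tendsto:
  assumes "\<And>n. J n \<subseteq> {j. 2 * j \<le> n}" "\<And>j. \<forall>\<^sub>F n in sequentially. j \<in> J n"
  shows "(\<lambda>n. (\<Sum>j\<in>J n. w j * decay (n - j)) / decay n) \<longlonglongrightarrow> w_total"
proof -
  have "(\<lambda>n. (\<Sum>j\<in>J n. w j * decay (n - j)) / decay n) \<longlonglongrightarrow> (\<Sum>n. w n) * 1"
    by (rule half_convolution_tendsto[OF _ _ assms]) (simp_all add: w_nonneg summable_w)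
  then show ?thesis
    by (simp add: suminf_w)
qed

text \<open>A priori bound from which the iteration in \<open>w_tendsto\<close> starts. By strong
  induction, the convolution reproduces a bound \<open>K\<close> with a factor close to
  \<open>w_total < 1\<close>.\<close>

lemma w_bounded:
  assumes u: "(\<lambda>n. u n / decay n) \<longlonglongrightarrow> C"
  obtains K where "K > 0" "\<And>n. w n \<le> K * decay n"
proof -
  obtain K0 where K0: "K0 > 0" "\<And>n. \<bar>u n\<bar> \<le> K0 * decay n"
    using bounded_of_tendsto_decay[OF u] by blast
  \<comment> \<open>The midpoint of \<open>w_total\<close> and 1 exceeds the limit of the half sums,
    hence bounds them from some \<open>N\<close> on.\<close>
  define q where "q = (1 + w_total) / 2"
  have q: "w_total < q" "q < 1" "q > 0"
    using w_total_bounds by (auto simp: q_def)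
  obtain N where N: "\<And>n. n \<ge> N \<Longrightarrow> (\<Sum>j | 2 * j \<le> n. w j * decay (n - j)) / decay n < q"
    using order_tendstoD(2)[OF half_sum_decay_tendsto[OF half_index_sets(1,3)] q(1)]
    unfolding eventually_sequentially by blast
  \<comment> \<open>The first summand ensures \<open>K0 + q * K <= K\<close>, which closes the
    induction; the second covers the indices below \<open>N\<close>.\<close>
  define K where "K = K0 / (1 - q) + (\<Sum>n<N. w n / decay n)"
  have S: "(\<Sum>n<N. w n / decay n) \<ge> 0"
    by (intro sum_nonneg) (simp add: w_nonneg)
  have Kpos: "K > 0"
    using S K0 q by (auto simp: K_def intro!: add_pos_nonneg)
  have K0K: "K0 + q * K \<le> K"
  proof -
    have "K0 / (1 - q) \<le> K"
      using S by (simp add: K_def)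
    then show ?thesis
      using q by (simp add: field_simps)
  qed
  have "w n \<le> K * decay n" for n
  proof (induction n rule: less_induct)
    case (less n)
    show ?case
    proof (cases "n < N")
      case True
      have "w n / decay n \<le> (\<Sum>n<N. w n / decay n)"
        by (rule member_le_sum) (use True in \<open>auto simp: w_nonneg\<close>)
      also have "\<dots> \<le> K"
        using K0 q by (simp add: K_def)
      finally show ?thesis
        by (simp add: field_simps)
    next
      case False
      have fin: "finite {j. 2 * j \<le> n}"
        by (rule finite_subset[of _ "{..n}"]) auto
      have "(\<Sum>j\<le>n. w j * w (n - j)) \<le> 2 * (\<Sum>j | 2 * j \<le> n. w j * w (n - j))"
      proof -
        have "(\<Sum>j | 2 * j < n. w j * w (n - j)) \<le> (\<Sum>j | 2 * j \<le> n. w j * w (n - j))"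
          by (rule sum_mono2[OF fin]) (auto simp: w_nonneg)
        then show ?thesis
          unfolding convolution_split by simp
      qed
      also have "(\<Sum>j | 2 * j \<le> n. w j * w (n - j)) \<le> (\<Sum>j | 2 * j \<le> n. w j * (K * decay (n - j)))"
      proof (rule sum_mono)
        fix j assume j: "j \<in> {j. 2 * j \<le> n}"
        show "w j * w (n - j) \<le> w j * (K * decay (n - j))"
        \<comment> \<open>For \<open>j = 0\<close> the induction hypothesis would concern
          \<open>n\<close> itself, but \<open>w 0 = 0\<close> removes that term.\<close>
        proof (cases "j = 0")
          case False
          then have "w (n - j) \<le> K * decay (n - j)"
            using j by (intro less) auto
          then show ?thesis
            by (intro mult_left_mono w_nonneg)
        qed (simp add: w_0)
      qed
      also have "\<dots> = K * (\<Sum>j | 2 * j \<le> n. w j * decay (n - j))"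
        by (simp add: sum_distrib_left mult_ac)
      also have "\<dots> \<le> K * (q * decay n)"
        using N[of n] False Kpos by (intro mult_left_mono) (auto simp: field_simps)
      finally have "2 * w n \<le> K0 * decay n + 2 * (K * (q * decay n))"
        using rec[of n] K0(2)[of n] by linarith
      also have "\<dots> \<le> 2 * ((K0 + q * K) * decay n)"
        using K0 by (simp add: algebra_simps)
      also have "\<dots> \<le> 2 * (K * decay n)"
        by (intro mult_left_mono mult_right_mono K0K) auto
      finally show ?thesis
        by simp
    qed
  qed
  then show thesis
    using Kpos by (intro that)
qed

text \<open>Dividing the recursion by \<open>decay n\<close> leads in the limit to
  \<open>L = C / 2 + w_total * L\<close>. An eventual bound \<open>B\<close> on the error
  \<open>e\<close> improves to \<open>q' * B\<close> with \<open>q' < 1\<close>, and iterating this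
  gives convergence.\<close>

lemma w_tendsto:
  assumes u: "(\<lambda>n. u n / decay n) \<longlonglongrightarrow> C"
  shows "(\<lambda>n. w n / decay n) \<longlonglongrightarrow> C / (2 * (1 - w_total))"
proof -
  define L where "L = C / (2 * (1 - w_total))"
  have L: "C / 2 + w_total * L = L"
  proof -
    have "C = 2 * (1 - w_total) * L"
      using w_total_bounds by (simp add: L_def)
    then show ?thesis
      by (simp add: algebra_simps)
  qed
  define e where "e n = \<bar>w n / decay n - L\<bar>" for n
  obtain K where K: "K > 0" "\<And>n. w n \<le> K * decay n"
    using w_bounded[OF u] by blast
  define q where "q = (1 + w_total) / 2"
  have q: "w_total < q" "q < 1" "q > 0"
    using w_total_bounds by (auto simp: q_def)
  have half: "\<forall>\<^sub>F n in sequentially. \<bar>(\<Sum>j\<in>J n. w j * w (n - j)) / decay n - w_total * L\<bar> < q * B"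
    if J: "\<And>n. J n \<subseteq> {j. 2 * j \<le> n}" "\<And>j. \<forall>\<^sub>F n in sequentially. j \<in> J n"
      and B: "B > 0" "\<forall>\<^sub>F n in sequentially. e n \<le> B" for J :: "nat \<Rightarrow> nat set" and B
  proof -
    \<comment> \<open>Comparing \<open>w (n - j)\<close> with \<open>L * decay (n - j)\<close>
      splits the deviation into weighted errors, at most \<open>B * T n\<close>, and
      \<open>L * (T n - w_total)\<close>, which tends to 0.\<close>
    define T where "T n = (\<Sum>j\<in>J n. w j * decay (n - j)) / decay n" for n
    have T: "T \<longlonglongrightarrow> w_total"
      unfolding T_def by (rule half_sum_decay_tendsto[OF J])
    then have "(\<lambda>n. B * T n + \<bar>L\<bar> * \<bar>T n - w_total\<bar>) \<longlonglongrightarrow> B * w_total + \<bar>L\<bar> * \<bar>w_total - w_total\<bar>"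
      by (intro tendsto_intros)
    moreover have "B * w_total + \<bar>L\<bar> * \<bar>w_total - w_total\<bar> < q * B"
      using q B by simp
    ultimately have ev: "\<forall>\<^sub>F n in sequentially. B * T n + \<bar>L\<bar> * \<bar>T n - w_total\<bar> < q * B"
      by (rule order_tendstoD(2))
    obtain N where N: "\<And>n. n \<ge> N \<Longrightarrow> e n \<le> B"
      using B(2) unfolding eventually_sequentially by blast
    show ?thesis
      using ev eventually_ge_at_top[of "2 * N"]
    proof eventually_elim
      case (elim n)
      have "\<bar>\<Sum>j\<in>J n. w j * (w (n - j) - L * decay (n - j))\<bar> \<le> (\<Sum>j\<in>J n. w j * (B * decay (n - j)))"
      proof (rule sum_abs[THEN order_trans], rule sum_mono)
        fix j assume "j \<in> J n"
        \<comment> \<open>From \<open>2 * j <= n\<close> and \<open>2 * N <= n\<close> the large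
          index is at least \<open>N\<close>, so the eventual bound on \<open>e\<close> applies to
          every term.\<close>
        then have "n - j \<ge> N"
          using J(1)[of n] elim by auto
        then have "e (n - j) * decay (n - j) \<le> B * decay (n - j)"
          by (intro mult_right_mono N) auto
        moreover have "e (n - j) * decay (n - j) = \<bar>(w (n - j) / decay (n - j) - L) * decay (n - j)\<bar>"
          by (simp add: e_def abs_mult)
        moreover have "(w (n - j) / decay (n - j) - L) * decay (n - j) = w (n - j) - L * decay (n - j)"
          by (simp add: left_diff_distrib)
        ultimately have "\<bar>w (n - j) - L * decay (n - j)\<bar> \<le> B * decay (n - j)"
          by simp
        then show "\<bar>w j * (w (n - j) - L * decay (n - j))\<bar> \<le> w j * (B * decay (n - j))"
          by (simp add: abs_mult w_nonneg mult_left_mono)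
      qed
      also have "\<dots> = B * T n * decay n"
        by (simp add: T_def) (simp add: sum_distrib_left mult_ac)
      finally have "\<bar>(\<Sum>j\<in>J n. w j * (w (n - j) - L * decay (n - j))) / decay n\<bar> \<le> B * T n"
        by (simp add: field_simps)
      moreover have "(\<Sum>j\<in>J n. w j * (w (n - j) - L * decay (n - j))) / decay n
          = ((\<Sum>j\<in>J n. w j * w (n - j)) / decay n - w_total * L) - L * (T n - w_total)"
        by (simp add: T_def right_diff_distrib sum_subtractf sum_distrib_left mult_ac diff_divide_distrib)
      moreover have "\<bar>L * (T n - w_total)\<bar> = \<bar>L\<bar> * \<bar>T n - w_total\<bar>"
        by (rule abs_mult)
      ultimately show ?case
        using elim(1) by linarith
    qed
  qed
  \<comment> \<open>The linear arithmetic of the contraction step, stated for abstract reals: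
    deviations \<open>d\<close>, \<open>s / 2\<close> and \<open>s / 2\<close> add up to
    \<open>r\<close>.\<close>
  have average: "\<bar>W - L\<bar> \<le> r"
    if "W = U / 2 + A / 2 + A' / 2" "d = r - s" "\<bar>U / 2 - c\<bar> < d" "\<bar>A - l\<bar> < s" "\<bar>A' - l\<bar> < s"
      "c + l = L" for W U A A' c d l r s :: real
  proof (rule abs_leI)
    show "W - L \<le> r" "- (W - L) \<le> r"
      using that unfolding abs_less_iff by linarith+
  qed
  \<comment> \<open>The gap between \<open>q\<close> and \<open>q'\<close> leaves room for the error
    of \<open>u\<close>.\<close>
  define q' where "q' = (1 + q) / 2"
  have q': "q < q'" "q' < 1" "q' > 0"
    using q by (auto simp: q'_def)
  have step: "\<forall>\<^sub>F n in sequentially. e n \<le> q' * B"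
    if B: "B > 0" "\<forall>\<^sub>F n in sequentially. e n \<le> B" for B
  proof -
    have "(\<lambda>n. u n / decay n / 2) \<longlonglongrightarrow> C / 2"
      by (intro tendsto_intros u) auto
    moreover have "(q' - q) * B > 0"
      using q' B by simp
    ultimately have "\<forall>\<^sub>F n in sequentially. \<bar>u n / decay n / 2 - C / 2\<bar> < (q' - q) * B"
      by (simp only: tendsto_iff dist_real_def)
    then show ?thesis
      using half[where J = "\<lambda>n. {j. 2 * j \<le> n}", OF half_index_sets(1,3) B]
        half[where J = "\<lambda>n. {j. 2 * j < n}", OF half_index_sets(2,4) B]
    proof eventually_elim
      case (elim n)
      have "w n = (u n + (\<Sum>j | 2 * j \<le> n. w j * w (n - j)) + (\<Sum>j | 2 * j < n. w j * w (n - j))) / 2"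
        using rec[of n] unfolding convolution_split by simp
      then have w_eq: "w n / decay n = u n / decay n / 2 + (\<Sum>j | 2 * j \<le> n. w j * w (n - j)) / decay n / 2
          + (\<Sum>j | 2 * j < n. w j * w (n - j)) / decay n / 2"
        by (simp only: add_divide_distrib divide_divide_eq_left mult.commute)
      show ?case
        unfolding e_def by (rule average[OF w_eq left_diff_distrib elim L])
    qed
  qed
  define B0 where "B0 = K + \<bar>L\<bar>"
  have B0: "B0 > 0"
    using K by (simp add: B0_def)
  have iter: "\<forall>\<^sub>F n in sequentially. e n \<le> q' ^ m * B0" for m
  proof (induction m)
    case 0
    have "e n \<le> B0" for n
    proof -
      have "w n / decay n \<le> K" "w n / decay n \<ge> 0"
        using K(2)[of n] by (auto simp: field_simps w_nonneg)
      then show ?thesis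
        unfolding e_def B0_def by linarith
    qed
    then show ?case by simp
  next
    case (Suc m)
    have "\<forall>\<^sub>F n in sequentially. e n \<le> q' * (q' ^ m * B0)"
      by (rule step[OF _ Suc.IH]) (use q' B0 in simp)
    then show ?case
      by (simp only: power_Suc mult.assoc)
  qed
  have e_nonneg: "e n \<ge> 0" for n
    by (simp add: e_def)
  have "e \<longlonglongrightarrow> 0"
  proof (rule order_tendstoI)
    fix a :: real assume "a > 0"
    have "norm q' < 1"
      using q' by simp
    then have "(\<lambda>m. q' ^ m * B0) \<longlonglongrightarrow> 0"
      by (intro tendsto_mult_left_zero LIMSEQ_power_zero)
    then have "\<forall>\<^sub>F m in sequentially. q' ^ m * B0 < a"
      using \<open>a > 0\<close> by (rule order_tendstoD(2))
    then obtain m where m: "q' ^ m * B0 < a"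
      unfolding eventually_sequentially by blast
    show "\<forall>\<^sub>F n in sequentially. e n < a"
      using iter[of m] by eventually_elim (use m in simp)
  next
    fix a :: real assume "a < 0"
    then show "\<forall>\<^sub>F n in sequentially. a < e n"
      using e_nonneg by (intro always_eventually allI) (rule less_le_trans)
  qed
  then have "(\<lambda>n. w n / decay n - L) \<longlonglongrightarrow> 0"
    unfolding e_def by (rule tendsto_rabs_zero_cancel)
  then show ?thesis
    unfolding L_def by (rule LIM_zero_cancel)
qed

end

section \<open>The innermost radical and the induction outwards\<close>

text \<open>The binomial series of \<open>sqrt (1 - a * X)\<close>.\<close>

definition sqrt_fps :: "real \<Rightarrow> real fps" where
  "sqrt_fps a = Abs_fps (\<lambda>n. (1/2 gchoose n) * (- a) ^ n)"

lemma sqrt_fps_nth: "fps_nth (sqrt_fps a) n = (1/2 gchoose n) * (- a) ^ n"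
  by (simp add: sqrt_fps_def)

text \<open>Rescaled form of the exponent law \<open>1/2 + 1/2 = 1\<close> for binomial
  series.\<close>

lemma sqrt_fps_square: "sqrt_fps a * sqrt_fps a = 1 - fps_const a * fps_X"
proof (rule fps_ext)
  fix n
  have "fps_nth (sqrt_fps a * sqrt_fps a) n
      = (\<Sum>j=0..n. (1/2 gchoose j) * (1/2 gchoose (n - j)) * (- a) ^ n)"
    unfolding fps_mult_nth sqrt_fps_nth
  proof (intro sum.cong refl)
    fix j assume "j \<in> {0..n}"
    then have "(- a) ^ n = (- a) ^ j * (- a) ^ (n - j)"
      by (simp flip: power_add)
    then show "(1/2 gchoose j) * (- a) ^ j * ((1/2 gchoose (n - j)) * (- a) ^ (n - j)) =
        (1/2 gchoose j) * (1/2 gchoose (n - j)) * (- a) ^ n"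
      by (simp only: mult_ac)
  qed
  also have "\<dots> = fps_nth (fps_binomial (1/2) * fps_binomial (1/2)) n * (- a) ^ n"
    by (simp add: fps_mult_nth sum_distrib_right)
  also have "fps_binomial (1/2 :: real) * fps_binomial (1/2) = 1 + fps_X"
    by (simp flip: fps_binomial_add_mult add: fps_binomial_1)
  also have "fps_nth (1 + fps_X) n * (- a) ^ n = fps_nth (1 - fps_const a * fps_X) n"
    by (cases n) auto
  finally show "fps_nth (sqrt_fps a * sqrt_fps a) n = fps_nth (1 - fps_const a * fps_X) n" .
qed

lemma Gamma_minus_half: "Gamma (- 1/2 :: real) = - 2 * sqrt pi"
proof -
  have "(- 1/2 :: real) \<notin> \<int>\<^sub>\<le>\<^sub>0"
  proof
    assume "(- 1/2 :: real) \<in> \<int>\<^sub>\<le>\<^sub>0"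
    then obtain n where "(- 1/2 :: real) = - of_nat n"
      by (elim nonpos_Ints_cases') 
    then have "real (2 * n) = real 1"
      by simp
    then show False
      unfolding of_nat_eq_iff by presburger
  qed
  from Gamma_plus1[OF this] show ?thesis
    by (simp add: Gamma_one_half_real)
qed

text \<open>The limit is \<open>1 / Gamma (-1/2)\<close>; the alternating sign of
  \<open>1/2 gchoose n\<close> cancels against the powers of -1 in the series.\<close>

lemma sqrt_fps_1_tendsto:
  "(\<lambda>n. fps_nth (sqrt_fps 1) n / decay n) \<longlonglongrightarrow> - 1 / (2 * sqrt pi)"
proof -
  have "(\<lambda>n. real n powr (-3/2) / decay n) \<longlonglongrightarrow> 1"
    unfolding decay_def by real_asymp
  moreover have "(\<lambda>n. (1/2 gchoose n) / ((-1)^n / exp ((1/2 + 1) * of_real (ln (real n)))))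
      \<longlonglongrightarrow> inverse (- 2 * sqrt pi)"
    using gbinomial_asymptotic[of "1/2 :: real"] Gamma_minus_half by simp
  ultimately have "(\<lambda>n. (1/2 gchoose n) / ((-1)^n / exp ((1/2 + 1) * of_real (ln (real n))))
      * (real n powr (-3/2) / decay n)) \<longlonglongrightarrow> inverse (- 2 * sqrt pi) * 1"
    by (intro tendsto_mult)
  moreover have "\<forall>\<^sub>F n in sequentially.
      (1/2 gchoose n) / ((-1)^n / exp ((1/2 + 1) * of_real (ln (real n)))) * (real n powr (-3/2) / decay n)
      = fps_nth (sqrt_fps 1) n / decay n"
    using eventually_gt_at_top[of 0]
  proof eventually_elim
    case (elim n)
    have "exp (3/2 * ln (real n)) * real n powr (-3/2) = 1"
      using elim by (simp add: powr_def flip: exp_add)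
    moreover have "(1/2 gchoose n) / ((-1)^n / E) * (P / d) = (1/2 gchoose n) * (-1)^n / d"
      if "E * P = 1" for E P d :: real
    proof -
      have "(1/2 gchoose n) / ((-1)^n / E) * (P / d) = (1/2 gchoose n) / (-1)^n * (E * P) / d"
        by simp
      also have "\<dots> = (1/2 gchoose n) * (-1)^n / d"
        unfolding that by (cases "even n") auto
      finally show ?thesis .
    qed
    ultimately show ?case
      by (simp add: sqrt_fps_nth)
  qed
  ultimately have "(\<lambda>n. fps_nth (sqrt_fps 1) n / decay n) \<longlonglongrightarrow> inverse (- 2 * sqrt pi) * 1"
    by (rule Lim_transform_eventually)
  then show ?thesis
    by (simp add: inverse_eq_divide)
qed

text \<open>The coefficients are those for \<open>a = 1\<close> times \<open>a ^ n\<close>, hence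
  geometrically smaller.\<close>

lemma sqrt_fps_tendsto_0:
  assumes "\<bar>a\<bar> < 1"
  shows "(\<lambda>n. fps_nth (sqrt_fps a) n / decay n) \<longlonglongrightarrow> 0"
proof -
  have "(\<lambda>n. fps_nth (sqrt_fps 1) n / decay n * a ^ n) \<longlonglongrightarrow> - 1 / (2 * sqrt pi) * 0"
    using assms by (intro tendsto_mult sqrt_fps_1_tendsto LIMSEQ_power_zero) simp
  moreover have "fps_nth (sqrt_fps 1) n * a ^ n = fps_nth (sqrt_fps a) n" for n
  proof -
    have "(-1) ^ n * a ^ n = (- a) ^ n"
      by (simp flip: power_mult_distrib)
    then show ?thesis
      by (simp add: sqrt_fps_nth mult.assoc)
  qed
  ultimately show ?thesis
    by simp
qed

lemma sums_product_fps:
  fixes f g :: "real fps"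
  assumes f: "summable (\<lambda>n. \<bar>fps_nth f n\<bar>)" and g: "summable (\<lambda>n. \<bar>fps_nth g n\<bar>)"
  shows "fps_nth (f * g) sums ((\<Sum>n. fps_nth f n) * (\<Sum>n. fps_nth g n))"
  using Cauchy_product_sums[of "fps_nth f" "fps_nth g"] f g
  by (simp add: fps_mult_nth[abs_def] atLeast0AtMost)

text \<open>Absolute convergence allows squaring the series at the boundary point 1, where
  \<open>1 - X\<close> vanishes.\<close>

lemma suminf_sqrt_fps_1: "(\<Sum>n. fps_nth (sqrt_fps 1) n) = 0"
proof -
  have "summable (\<lambda>n. \<bar>fps_nth (sqrt_fps 1) n\<bar>)"
    by (rule summable_of_tendsto_decay[OF sqrt_fps_1_tendsto])
  from sums_product_fps[OF this this]
  have "fps_nth (1 - fps_X) sums ((\<Sum>n. fps_nth (sqrt_fps 1) n) * (\<Sum>n. fps_nth (sqrt_fps 1) n))"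
    by (simp add: sqrt_fps_square)
  moreover have "fps_nth (1 - fps_X :: real fps) sums (\<Sum>n\<in>{0, 1}. fps_nth (1 - fps_X) n)"
    by (rule sums_finite) auto
  ultimately show ?thesis
    by (auto dest: sums_unique2)
qed

section \<open>The nested radicals, rescaled so that the singularity lies at 1\<close>

context
  fixes k :: nat and \<rho> :: real
  assumes k: "k \<ge> 1" and \<rho>_def: "\<rho> = 1 / (1 + 2 * sqrt (real k))"
begin

text \<open>
  In the paper's notation \<open>radical_fps i\<close> is \<open>2 z P\<^sup>(\<^sup>i\<^sup>,\<^sup>k\<^sup>)\<close> at \<open>\<rho> z\<close>, that is, for
  \<open>i < k\<close>, one minus the square root of the radicand.
\<close>

definition radical_fps :: "nat \<Rightarrow> real fps" where
  "radical_fps i = fps_const (2 * \<rho>) * fps_X * tree_fps k \<rho> i"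

lemma \<rho>_pos: "\<rho> > 0"
  by (simp add: \<rho>_def add_pos_nonneg)

lemma \<rho>_inverse: "(1 + 2 * sqrt (real k)) * \<rho> = 1"
  using \<rho>_pos by (simp add: \<rho>_def)

lemma radical_fps_nth:
  "fps_nth (radical_fps i) n = (if n = 0 then 0 else 2 * \<rho> * fps_nth (tree_fps k \<rho> i) (n - 1))"
  unfolding radical_fps_def mult.assoc by (simp add: fps_X_mult_nth)

lemma radical_fps_nonneg: "fps_nth (radical_fps i) n \<ge> 0"
  using \<rho>_pos by (simp add: radical_fps_nth tree_fps_nth sum_nonneg)

text \<open>The factor \<open>2 * \<rho> * X\<close> brings the tree recursion into the form
  \<open>2 * w = u + w^2\<close> of \<open>sqrt_recursion\<close>, with \<open>u\<close> determined
  by the next level.\<close>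

lemma radical_fps_eq:
  "2 * radical_fps i = fps_const (4 * \<rho>\<^sup>2 * real (min k i)) * fps_X\<^sup>2
    + fps_const (2 * \<rho>) * fps_X * radical_fps (Suc i) + radical_fps i * radical_fps i"
proof -
  let ?P = "tree_fps k \<rho>" and ?r = "fps_const \<rho>" and ?m = "fps_const (real (min k i))"
  have c: "fps_const (4 * \<rho>\<^sup>2 * real (min k i)) = 4 * (?r * ?r * ?m)" "fps_const (2 * \<rho>) = 2 * ?r"
    by (simp_all add: power2_eq_square numeral_fps_const mult.assoc)
  have "2 * radical_fps i = 4 * (?r * fps_X * ?P i)"
    by (simp only: radical_fps_def c) (simp add: mult.assoc)
  also have "?P i = ?r * fps_X * (?m + ?P (Suc i) + ?P i * ?P i)"
    by (rule tree_fps_eq)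
  finally show ?thesis
    unfolding radical_fps_def c by (simp add: algebra_simps power2_eq_square)
qed

text \<open>The reciprocals of 1 and \<open>\<tau>\<close> are the zeros of the innermost radicand
  \<open>(1 - \<rho> * X)^2 - 4 * k * \<rho>^2 * X^2\<close>.\<close>

definition \<tau> :: real where "\<tau> = (1 - 2 * sqrt (real k)) * \<rho>"

lemma abs_\<tau>: "\<bar>\<tau>\<bar> < 1"
proof -
  have "sqrt (real k) > 0"
    using k by simp
  then have "\<bar>1 - 2 * sqrt (real k)\<bar> * \<rho> < (1 + 2 * sqrt (real k)) * \<rho>"
    using \<rho>_pos by (intro mult_strict_right_mono) linarith+
  then show ?thesis
    using \<rho>_pos \<rho>_inverse by (simp add: \<tau>_def abs_mult)
qed

text \<open>Levels \<open>k\<close> and \<open>Suc k\<close> coincide, so the recursion becomes a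
  quadratic equation for \<open>radical_fps k\<close>. The left side is a square root of its
  discriminant, which splits into two linear factors.\<close>

lemma radical_fps_k: "1 - fps_const \<rho> * fps_X - radical_fps k = sqrt_fps 1 * sqrt_fps \<tau>"
proof -
  define r M where "r = fps_const \<rho>" and "M = fps_const (4 * real k)"
  let ?V = "1 - fps_const \<rho> * fps_X - radical_fps k"
  have same_level: "radical_fps (Suc k) = radical_fps k"
    by (simp add: radical_fps_def tree_fps_cong[of k "Suc k" k])
  have c: "fps_const (4 * \<rho>\<^sup>2 * real k) = r * r * M" "fps_const (2 * \<rho>) = 2 * r"
    by (simp_all add: r_def M_def power2_eq_square numeral_fps_const mult_ac)
  have "?V * ?V = 1 - 2 * r * fps_X + r * r * fps_X\<^sup>2
      + (2 * r * fps_X * radical_fps k + radical_fps k * radical_fps k - 2 * radical_fps k)"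
    unfolding r_def[symmetric] by (simp add: algebra_simps power2_eq_square)
  also have "2 * radical_fps k = r * r * M * fps_X\<^sup>2 + 2 * r * fps_X * radical_fps k + radical_fps k * radical_fps k"
    using radical_fps_eq[of k] by (simp only: same_level c min.idem)
  finally have "?V * ?V = 1 - 2 * r * fps_X + r * r * fps_X\<^sup>2 * (1 - M)"
    by (simp add: algebra_simps)
  also have "\<dots> = (1 - fps_X) * (1 - fps_const \<tau> * fps_X)"
  proof -
    \<comment> \<open>The factorisation amounts to the sum and the product of 1 and
      \<open>\<tau>\<close>.\<close>
    have 2: "1 + \<tau> = 2 * \<rho>"
      using \<rho>_inverse by (simp add: \<tau>_def algebra_simps)
    have "\<tau> = \<rho> * \<rho> * (1 - 4 * real k)"
    proof -
      have "\<tau> = (1 - 2 * sqrt (real k)) * \<rho> * ((1 + 2 * sqrt (real k)) * \<rho>)"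
        by (simp only: \<rho>_inverse \<tau>_def mult_1_right)
      also have "\<dots> = \<rho> * \<rho> * (1 - 4 * (sqrt (real k) * sqrt (real k)))"
        by (simp only: algebra_simps)
      finally show ?thesis by simp
    qed
    then have 3: "fps_const \<tau> = r * r * (1 - M)"
      by (simp only: r_def M_def fps_const_mult fps_const_sub fps_const_1_eq_1[symmetric])
    have "2 * r = 1 + fps_const \<tau>"
      using 2 by (simp add: r_def numeral_fps_const flip: fps_const_1_eq_1)
    then have "1 - 2 * r * fps_X + r * r * fps_X\<^sup>2 * (1 - M)
        = 1 - (1 + fps_const \<tau>) * fps_X + fps_const \<tau> * fps_X\<^sup>2"
      by (simp only: 3 mult_ac)
    then show ?thesis
      by (simp add: algebra_simps power2_eq_square)
  qed
  also have "\<dots> = (sqrt_fps 1 * sqrt_fps 1) * (sqrt_fps \<tau> * sqrt_fps \<tau>)"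
    by (simp add: sqrt_fps_square)
  also have "\<dots> = (sqrt_fps 1 * sqrt_fps \<tau>) * (sqrt_fps 1 * sqrt_fps \<tau>)"
    by (simp only: mult_ac)
  finally have "?V = sqrt_fps 1 * sqrt_fps \<tau> \<or> ?V = - (sqrt_fps 1 * sqrt_fps \<tau>)"
    by (simp only: square_eq_iff)
  \<comment> \<open>Both series have constant coefficient 1, which fixes the sign of the
    root.\<close>
  moreover have "?V \<noteq> - (sqrt_fps 1 * sqrt_fps \<tau>)"
  proof
    assume "?V = - (sqrt_fps 1 * sqrt_fps \<tau>)"
    then have "fps_nth ?V 0 = - fps_nth (sqrt_fps 1 * sqrt_fps \<tau>) 0"
      by (simp only: fps_neg_nth)
    then show False
      by (simp add: radical_fps_nth sqrt_fps_nth)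
  qed
  ultimately show ?thesis
    by blast
qed

lemma radical_fps_k_nth:
  "fps_nth (radical_fps k) n = (if n = 0 then 1 else 0) - (if n = 1 then \<rho> else 0)
    - fps_nth (sqrt_fps 1 * sqrt_fps \<tau>) n"
  unfolding radical_fps_k[symmetric] by (simp add: fps_X_def)

text \<open>The radical vanishes at 1 through its factor \<open>sqrt_fps 1\<close>, so only the
  linear part is left.\<close>

lemma radical_fps_k_sums: "fps_nth (radical_fps k) sums (1 - \<rho>)"
proof -
  have "summable (\<lambda>n. \<bar>fps_nth (sqrt_fps 1) n\<bar>)" "summable (\<lambda>n. \<bar>fps_nth (sqrt_fps \<tau>) n\<bar>)"
    using summable_of_tendsto_decay[OF sqrt_fps_1_tendsto]
      summable_of_tendsto_decay[OF sqrt_fps_tendsto_0[OF abs_\<tau>]] .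
  from sums_product_fps[OF this] have "fps_nth (sqrt_fps 1 * sqrt_fps \<tau>) sums 0"
    by (simp add: suminf_sqrt_fps_1)
  then have "(\<lambda>n. (if n = 0 then 1 else 0) - (if n = 1 then \<rho> else 0)
      - fps_nth (sqrt_fps 1 * sqrt_fps \<tau>) n) sums (1 - \<rho> - 0)"
    by (intro sums_diff sums_single)
  then show ?thesis
    by (simp add: radical_fps_k_nth[abs_def])
qed

text \<open>The singular factor \<open>sqrt_fps 1\<close> determines the order of decay, and the
  other factor enters through its value \<open>sqrt (1 - \<tau>)\<close> at 1.\<close>

lemma radical_fps_k_tendsto:
  "(\<lambda>n. fps_nth (radical_fps k) n / decay n) \<longlonglongrightarrow> sqrt (4 * sqrt (real k) * \<rho>) / (2 * sqrt pi)"
proof -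
  have "fps_nth (sqrt_fps \<tau>) sums sqrt (1 + - \<tau>)"
    using sqrt_series[of "- \<tau>"] abs_\<tau> by (simp add: sqrt_fps_nth[abs_def])
  moreover have "1 + - \<tau> = 4 * sqrt (real k) * \<rho>"
  proof -
    show ?thesis
      using \<rho>_inverse by (simp add: \<tau>_def algebra_simps)
  qed
  ultimately have s: "(\<Sum>n. fps_nth (sqrt_fps \<tau>) n) = sqrt (4 * sqrt (real k) * \<rho>)"
    by (simp add: sums_iff)
  have "(\<lambda>n. fps_nth (sqrt_fps 1 * sqrt_fps \<tau>) n / decay n) \<longlonglongrightarrow>
      (\<Sum>n. fps_nth (sqrt_fps 1) n) * 0 + sqrt (4 * sqrt (real k) * \<rho>) * (- 1 / (2 * sqrt pi))"
    unfolding fps_mult_nth atLeast0AtMost s[symmetric]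
    by (rule convolution_tendsto[OF sqrt_fps_1_tendsto sqrt_fps_tendsto_0[OF abs_\<tau>]])
  then have "(\<lambda>n. - (fps_nth (sqrt_fps 1 * sqrt_fps \<tau>) n / decay n)) \<longlonglongrightarrow>
      - ((\<Sum>n. fps_nth (sqrt_fps 1) n) * 0 + sqrt (4 * sqrt (real k) * \<rho>) * (- 1 / (2 * sqrt pi)))"
    by (rule tendsto_minus)
  moreover have "\<forall>\<^sub>F n in sequentially.
      - (fps_nth (sqrt_fps 1 * sqrt_fps \<tau>) n / decay n) = fps_nth (radical_fps k) n / decay n"
    using eventually_gt_at_top[of 1] by eventually_elim (simp add: radical_fps_k_nth)
  ultimately have "(\<lambda>n. fps_nth (radical_fps k) n / decay n) \<longlonglongrightarrow>
      - ((\<Sum>n. fps_nth (sqrt_fps 1) n) * 0 + sqrt (4 * sqrt (real k) * \<rho>) * (- 1 / (2 * sqrt pi)))"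
    by (rule Lim_transform_eventually)
  then show ?thesis
    by simp
qed

text \<open>With radicand \<open>(\<rho> * t)^2\<close> at 1, the square root multiplies the limit
  \<open>2 * \<rho> * D\<close> for \<open>u\<close> by \<open>1 / (2 * \<rho> * t)\<close>.\<close>

lemma radical_fps_step:
  assumes i: "i < k" and s: "fps_nth (radical_fps (Suc i)) sums s"
    and D: "(\<lambda>n. fps_nth (radical_fps (Suc i)) n / decay n) \<longlonglongrightarrow> D"
    and t: "t > 0" "1 - 4 * \<rho>\<^sup>2 * real i - 2 * \<rho> * s = (\<rho> * t)\<^sup>2"
  shows "fps_nth (radical_fps i) sums (1 - \<rho> * t)"
    "(\<lambda>n. fps_nth (radical_fps i) n / decay n) \<longlonglongrightarrow> D / t"
proof -
  \<comment> \<open>The coefficients of 1 minus the radicand: the leaf term at index 2, where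
    \<open>min k i\<close> is \<open>i\<close>, and the next level shifted by one.\<close>
  define u where "u n = (if n = 2 then 4 * \<rho>\<^sup>2 * real i else 0) +
    2 * \<rho> * (if n = 0 then 0 else fps_nth (radical_fps (Suc i)) (n - 1))" for n
  have u: "fps_nth (fps_const (4 * \<rho>\<^sup>2 * real (min k i)) * fps_X\<^sup>2
      + fps_const (2 * \<rho>) * fps_X * radical_fps (Suc i)) n = u n"
    for n
    using i unfolding mult.assoc by (simp add: u_def fps_X_power_iff fps_X_mult_nth)
  have "(\<lambda>n. if n = 0 then 0 else fps_nth (radical_fps (Suc i)) (n - 1)) sums s"
    using s sums_Suc_iff[of "\<lambda>n. if n = 0 then 0 else fps_nth (radical_fps (Suc i)) (n - 1)" s] by simp
  then have "u sums (4 * \<rho>\<^sup>2 * real i + 2 * \<rho> * s)"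
    unfolding u_def by (intro sums_add sums_single sums_mult)
  then have u_sum: "summable u" "(\<Sum>n. u n) = 1 - (\<rho> * t)\<^sup>2"
    using t by (auto simp: sums_iff)
  have "(\<lambda>n. fps_nth (radical_fps (Suc i)) (n - 1) / decay n) \<longlonglongrightarrow> D"
    by (rule tendsto_decay_shift[OF D])
  then have "(\<lambda>n. 2 * \<rho> * (fps_nth (radical_fps (Suc i)) (n - 1) / decay n)) \<longlonglongrightarrow> 2 * \<rho> * D"
    by (intro tendsto_mult tendsto_const)
  moreover have "\<forall>\<^sub>F n in sequentially.
      2 * \<rho> * (fps_nth (radical_fps (Suc i)) (n - 1) / decay n) = u n / decay n"
    using eventually_gt_at_top[of 2] by eventually_elim (simp add: u_def)
  ultimately have u_lim: "(\<lambda>n. u n / decay n) \<longlonglongrightarrow> 2 * \<rho> * D"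
    by (rule Lim_transform_eventually)
  interpret sqrt_recursion u "fps_nth (radical_fps i)"
  proof
    show "2 * fps_nth (radical_fps i) n = u n
      + (\<Sum>j\<le>n. fps_nth (radical_fps i) j * fps_nth (radical_fps i) (n - j))" for n
    proof -
      have "2 * fps_nth (radical_fps i) n = fps_nth (2 * radical_fps i) n"
        by (simp add: numeral_fps_const)
      then show ?thesis
        unfolding radical_fps_eq u[symmetric]
        by (simp only: fps_add_nth fps_mult_nth[of "radical_fps i"] atLeast0AtMost)
    qed
  qed (use \<rho>_pos t u_sum in \<open>auto simp: u_def radical_fps_nonneg radical_fps_nth[of i 0]\<close>)
  have w_total: "w_total = 1 - \<rho> * t"
    using \<rho>_pos t by (simp add: w_total_def u_sum)
  show "fps_nth (radical_fps i) sums (1 - \<rho> * t)"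
    using summable_w suminf_w by (simp add: sums_iff w_total)
  show "(\<lambda>n. fps_nth (radical_fps i) n / decay n) \<longlonglongrightarrow> D / t"
    using w_tendsto[OF u_lim] \<rho>_pos by (simp add: w_total)
qed

section \<open>The constants \<open>c\<close> and the resulting asymptotics\<close>

context
  fixes c :: "nat \<Rightarrow> real"
  assumes c_1: "c 1 = 1"
    and c_rec: "\<And>j. 2 \<le> j \<Longrightarrow> j \<le> k + 1 \<Longrightarrow> c j = 4 * real j - 5 + 2 * sqrt (c (j - 1))"
begin

lemma c_ge_1: "m \<le> k \<Longrightarrow> c (Suc m) \<ge> 1"
proof (induction m)
  case (Suc m)
  then show ?case
    using c_rec[of "Suc (Suc m)"] by simp
qed (use c_1 in simp)

text \<open>Here \<open>m\<close> counts levels outwards from the innermost one. Each step outwards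
  divides the limit by the new \<open>sqrt (c j)\<close>. At \<open>m = 0\<close> the value
  \<open>c 1 = 1\<close> encodes the linear term \<open>\<rho>\<close>, and the product is
  empty.\<close>

lemma radical_fps_asymp:
  assumes "m \<le> k"
  shows "fps_nth (radical_fps (k - m)) sums (1 - \<rho> * sqrt (c (Suc m))) \<and>
    (\<lambda>n. fps_nth (radical_fps (k - m)) n / decay n) \<longlonglongrightarrow>
      sqrt (4 * sqrt (real k) * \<rho>) / (2 * sqrt pi) / sqrt (\<Prod>j=2..m + 1. c j)"
  using assms
proof (induction m)
  case 0
  then show ?case
    using radical_fps_k_sums radical_fps_k_tendsto c_1 by simp
next
  case (Suc m)
  define i where "i = k - Suc m"
  define D where "D = sqrt (4 * sqrt (real k) * \<rho>) / (2 * sqrt pi) / sqrt (\<Prod>j=2..m + 1. c j)"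
  define t where "t = sqrt (c (Suc (Suc m)))"
  have i: "i < k" "k - m = Suc i" "real i = real k - real m - 1"
    using Suc.prems by (auto simp: i_def of_nat_diff)
  have t: "t > 0" "t\<^sup>2 = 4 * real m + 3 + 2 * sqrt (c (Suc m))"
    using c_ge_1[OF Suc.prems] c_rec[of "Suc (Suc m)"] Suc.prems by (auto simp: t_def)
  \<comment> \<open>After completing the square, \<open>1 - \<rho> = 2 * sqrt k * \<rho>\<close>
    gives every term the factor \<open>\<rho>^2\<close>; what remains is the recursion for
    \<open>c\<close>.\<close>
  have "1 - 4 * \<rho>\<^sup>2 * real i - 2 * \<rho> * (1 - \<rho> * sqrt (c (Suc m)))
    = (1 - \<rho>)\<^sup>2 - \<rho>\<^sup>2 * (4 * real i + 1 - 2 * sqrt (c (Suc m)))"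
    by (simp add: power2_eq_square algebra_simps)
  also have "1 - \<rho> = 2 * sqrt (real k) * \<rho>"
    using \<rho>_inverse by (simp add: algebra_simps)
  also have "(2 * sqrt (real k) * \<rho>)\<^sup>2 = 4 * real k * \<rho>\<^sup>2"
    by (simp add: power_mult_distrib)
  also have "4 * real k * \<rho>\<^sup>2 - \<rho>\<^sup>2 * (4 * real i + 1 - 2 * sqrt (c (Suc m))) = (\<rho> * t)\<^sup>2"
    unfolding power_mult_distrib t(2) i(3) by (simp add: algebra_simps)
  finally have eq: "1 - 4 * \<rho>\<^sup>2 * real i - 2 * \<rho> * (1 - \<rho> * sqrt (c (Suc m))) = (\<rho> * t)\<^sup>2" .
  have "fps_nth (radical_fps (Suc i)) sums (1 - \<rho> * sqrt (c (Suc m)))"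
    "(\<lambda>n. fps_nth (radical_fps (Suc i)) n / decay n) \<longlonglongrightarrow> D"
    using Suc.IH Suc.prems unfolding i(2) D_def by auto
  note radical_fps_step[OF i(1) this t(1) eq]
  moreover have "D / t = sqrt (4 * sqrt (real k) * \<rho>) / (2 * sqrt pi) / sqrt (\<Prod>j=2..Suc m + 1. c j)"
  proof -
    have "(\<Prod>j=2..Suc m + 1. c j) = (\<Prod>j=2..m + 1. c j) * c (Suc (Suc m))"
      using prod.nat_ivl_Suc'[of 2 "m + 1" c] by simp
    then show ?thesis
      by (simp only: D_def t_def real_sqrt_mult divide_divide_eq_left mult.assoc)
  qed
  ultimately show ?case
    by (simp only: i_def t_def simp_thms)
qed

lemma c_prod_pos: "(\<Prod>j=2..k + 1. c j) > 0"
proof (rule prod_pos)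
  fix j assume "j \<in> {2..k + 1}"
  then have "c (Suc (j - 1)) \<ge> 1" "Suc (j - 1) = j"
    using c_ge_1[of "j - 1"] by auto
  then show "c j > 0"
    by simp
qed

lemma G_le_asymp:
  "fps_nth (G_le k) \<sim>[at_top]
    (\<lambda>n. sqrt ((2 * real k + sqrt (real k)) / (4 * pi * (\<Prod>j = 2..k + 1. c j)))
          * real n powr (-3/2) * (1 + 2 * sqrt (real k)) ^ n)"
proof -
  let ?p = "\<Prod>j = 2..k + 1. c j"
  define C where "C = sqrt ((2 * real k + sqrt (real k)) / (4 * pi * ?p))"
  have C: "C > 0"
    using k c_prod_pos by (auto simp: C_def intro!: divide_pos_pos mult_pos_pos add_pos_nonneg)
  \<comment> \<open>This rests on \<open>(2 * k + sqrt k) * \<rho> = sqrt k\<close>.\<close>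
  have "sqrt (4 * sqrt (real k) * \<rho>) / (2 * sqrt pi) / sqrt ?p = 2 * \<rho> * C"
  proof -
    have "2 * real k + sqrt (real k) = sqrt (real k) * (1 + 2 * sqrt (real k))"
      by (simp add: algebra_simps)
    then have "(2 * real k + sqrt (real k)) * \<rho> = sqrt (real k)"
      using \<rho>_inverse by (simp only: mult.assoc mult_1_right)
    moreover have "4 * (a * \<rho>) * \<rho> / (2\<^sup>2 * pi * ?p) = (2 * \<rho>)\<^sup>2 * (a / (4 * pi * ?p))" for a
      by (simp add: power2_eq_square)
    ultimately have "4 * sqrt (real k) * \<rho> / (2\<^sup>2 * pi * ?p) = (2 * \<rho>)\<^sup>2 * ((2 * real k + sqrt (real k)) / (4 * pi * ?p))"
      by metis
    then have "sqrt (4 * sqrt (real k) * \<rho> / (2\<^sup>2 * pi * ?p)) = 2 * \<rho> * C"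
      using \<rho>_pos by (simp only: real_sqrt_mult C_def real_sqrt_abs)
    then show ?thesis
      by (simp add: real_sqrt_divide real_sqrt_mult)
  qed
  then have lim: "(\<lambda>n. fps_nth (radical_fps 0) n / decay n) \<longlonglongrightarrow> 2 * \<rho> * C"
    using radical_fps_asymp[of k] by simp
  \<comment> \<open>The factor \<open>2 * \<rho> * X\<close> in \<open>radical_fps 0\<close> moves
    the coefficient of size \<open>n\<close> to index \<open>Suc n\<close>.\<close>
  have "(\<lambda>n. fps_nth (radical_fps 0) (Suc n) / decay (Suc n) * (decay (Suc n) / real n powr (-3/2)) / (2 * \<rho> * C))
      \<longlonglongrightarrow> 2 * \<rho> * C * 1 / (2 * \<rho> * C)"
  proof (intro tendsto_divide tendsto_mult tendsto_const)
    show "(\<lambda>n. fps_nth (radical_fps 0) (Suc n) / decay (Suc n)) \<longlonglongrightarrow> 2 * \<rho> * C"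
      by (rule LIMSEQ_Suc[OF lim])
    show "(\<lambda>n. decay (Suc n) / real n powr (-3/2)) \<longlonglongrightarrow> 1"
      unfolding decay_def by real_asymp
  qed (use C \<rho>_pos in simp)
  moreover have "2 * \<rho> * C * 1 / (2 * \<rho> * C) = 1"
    using C \<rho>_pos by simp
  \<comment> \<open>This also holds at \<open>n = 0\<close>, where \<open>0 powr (-3/2) = 0\<close>
    makes both sides 0 by division by zero.\<close>
  moreover have "fps_nth (radical_fps 0) (Suc n) / decay (Suc n) * (decay (Suc n) / real n powr (-3/2)) / (2 * \<rho> * C)
    = fps_nth (G_le k) n / (C * real n powr (-3/2) * (1 + 2 * sqrt (real k)) ^ n)" for n
  proof -
    have "\<rho> ^ n = 1 / (1 + 2 * sqrt (real k)) ^ n"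
      by (simp add: \<rho>_def power_divide)
    then have "fps_nth (radical_fps 0) (Suc n) = 2 * \<rho> * (fps_nth (G_le k) n / (1 + 2 * sqrt (real k)) ^ n)"
      by (simp add: radical_fps_nth flip: fps_nth_G_le)
    then show ?thesis
      using C \<rho>_pos by (simp add: mult_ac)
  qed
  ultimately have "(\<lambda>n. fps_nth (G_le k) n / (C * real n powr (-3/2) * (1 + 2 * sqrt (real k)) ^ n)) \<longlonglongrightarrow> 1"
    by simp
  then show ?thesis
    unfolding C_def by (rule asymp_equivI')
qed

end

end

theorem theorem1:
  fixes k :: nat and c :: "nat \<Rightarrow> real"
  assumes "k \<ge> 1"
    and "c 1 = 1"
    and "\<And>j. 2 \<le> j \<Longrightarrow> j \<le> k + 1 \<Longrightarrow> c j = 4 * real j - 5 + 2 * sqrt (c (j - 1))"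
  shows "(\<lambda>n. fps_nth (G_le k) n) \<sim>[at_top]
    (\<lambda>n. sqrt ((2 * real k + sqrt (real k)) / (4 * pi * (\<Prod>j = 2..k + 1. c j)))
          * real n powr (-3/2) * (1 + 2 * sqrt (real k)) ^ n)"
  using G_le_asymp[OF assms(1) refl assms(2,3)] by simp

end
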